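(* Let $A:=P\cap S(\gamma)$ be the compact slice of the upper image $P=\Gamma(X)+C$, and let $A_0\supseteq A$ be a compact polytope. Let $M_k\in\mathbb{R}^{q\times q}$ ($k\ge0$) be symmetric positive definite matrices satisfying, for some constants $0<m\le M<\infty$, the uniform spectral bounds $$mI\preceq M_k\preceq MI\qquad\forall k\ge0 .$$ Assume the scalarizations $(P_{M_k}(v))$ are solved exactly, each returning an optimal displacement $z^v$ with $\|z^v\|_{M_k}=d_{M_k}(v,A)$. At each iteration $k$ select $$v^k\in\arg\max\{\|z^v\|_{M_k}: v\in\operatorname{ext}(A_k)\},$$ where $z^v$ is the $z$-part of the optimal solution of $(P_{M_k}(v))$. At each nonterminal iteration $k$ (i.e. $z^{v^k}\ne0$) set $$y^k=v^k+z^{v^k},\qquad g^k=\frac{M_kz^{v^k}}{\|z^{v^k}\|_{M_k}},\qquad H_{k+1}=\{y\in\mathbb{R}^q:(g^k)^\top y\ge(g^k)^\top y^k\},\qquad A_{k+1}=A_k\cap H_{k+1}$$ (so that $A\subseteq H_{k+1}$). Then $$\delta_H(A_k,A;\|\cdot\|_2)\to0\quad\text{as }k\to\infty;$$ equivalently, $\max_{v\in\operatorname{ext}(A_k)}d_2(v,A)\to0$.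
   Context: Problem setting. $C\subset\mathbb{R}^q$ is a closed convex cone that is solid (nonempty interior), pointed ($C\cap(-C)=\{0\}$), nontrivial and polyhedral; $C^+=\{w\in\mathbb{R}^q: w^\top y\ge 0\ \forall y\in C\}$, and $y\le_C z$ means $z-y\in C$. $X\subset\mathbb{R}^n$ is nonempty, compact, convex with nonempty interior. $\Gamma:X\to\mathbb{R}^q$ is continuous and $C$-convex: $\Gamma(\lambda x_1+(1-\lambda)x_2)\le_C\lambda\Gamma(x_1)+(1-\lambda)\Gamma(x_2)$ for all $x_1,x_2\in X$, $\lambda\in[0,1]$. $P=\Gamma(X)+C$. Fix $\bar w\in\operatorname{int}C^+$ and $\gamma=\sup_{x\in X}\bar w^\top\Gamma(x)+\alpha$ with $\alpha>0$ large enough that $\Gamma(X)\subset\operatorname{int}S(\gamma)$, where $S(\gamma)=\{y\in\mathbb{R}^q:\bar w^\top y\le\gamma\}$. The slice $A=P\cap S(\gamma)$ is nonempty, convex and compact. Scalarization. For symmetric $N\succ0$ let $\|d\|_N=\sqrt{d^\top Nd}$ and $d_N(v,A)=\inf_{y\in A}\|v-y\|_N$. For $v\in\mathbb{R}^q$, $(P_N(v))$ is: minimize $\|z\|_N$ over $x\in X$, $z\in\mathbb{R}^q$ subject to $\Gamma(x)-z-v\le_C0$ and $\bar w^\top(v+z)\le\gamma$. Notation. $\preceq$ is the Loewner order; $\operatorname{ext}(\cdot)$ is the vertex set; $d_2(v,A)=\inf_{y\in A}\|v-y\|_2$; $\delta_H(\cdot,\cdot;\|\cdot\|_2)$ is the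 Euclidean Hausdorff distance. If an iteration $k$ is terminal ($z^{v^k}=0$), then all vertices of $A_k$ lie in $A$, so $A_k=A$, and one sets $A_j=A_k$ for $j\ge k$. *)

theory Defs
  imports "HOL-Analysis.Analysis" "HOL-Library.Set_Algebras"
begin

definition cone_le :: "(real^'q) set \<Rightarrow> real^'q \<Rightarrow> real^'q \<Rightarrow> bool" where
  "cone_le C y z \<longleftrightarrow> z - y \<in> C"

definition dual_cone :: "(real^'q) set \<Rightarrow> (real^'q) set" where
  "dual_cone C = {w. \<forall>y\<in>C. 0 \<le> w \<bullet> y}"

definition cone_convex_on ::
    "(real^'q) set \<Rightarrow> (real^'n) set \<Rightarrow> (real^'n \<Rightarrow> real^'q) \<Rightarrow> bool" where
  "cone_convex_on C X \<Gamma> \<longleftrightarrow>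
     (\<forall>x1\<in>X. \<forall>x2\<in>X. \<forall>l\<in>{0..1}.
        cone_le C (\<Gamma> (l *\<^sub>R x1 + (1 - l) *\<^sub>R x2)) (l *\<^sub>R \<Gamma> x1 + (1 - l) *\<^sub>R \<Gamma> x2))"

text \<open>The set addition is the Minkowski sum.\<close>

definition upper_image ::
    "(real^'n \<Rightarrow> real^'q) \<Rightarrow> (real^'n) set \<Rightarrow> (real^'q) set \<Rightarrow> (real^'q) set" where
  "upper_image \<Gamma> X C = \<Gamma> ` X + C"

definition lower_halfspace :: "real^'q \<Rightarrow> real \<Rightarrow> (real^'q) set" where
  "lower_halfspace w \<gamma> = {y. w \<bullet> y \<le> \<gamma>}"

definition psd_matrix :: "real^'q^'q \<Rightarrow> bool" where
  "psd_matrix N \<longleftrightarrow> transpose N = N \<and> (\<forall>d. 0 \<le> d \<bullet> (N *v d))"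

definition spd_matrix :: "real^'q^'q \<Rightarrow> bool" where
  "spd_matrix N \<longleftrightarrow> transpose N = N \<and> (\<forall>d. d \<noteq> 0 \<longrightarrow> 0 < d \<bullet> (N *v d))"

definition loewner_le :: "real^'q^'q \<Rightarrow> real^'q^'q \<Rightarrow> bool" where
  "loewner_le N1 N2 \<longleftrightarrow> psd_matrix (N2 - N1)"

definition mnorm :: "real^'q^'q \<Rightarrow> real^'q \<Rightarrow> real" where
  "mnorm N d = sqrt (d \<bullet> (N *v d))"

definition minfdist :: "real^'q^'q \<Rightarrow> real^'q \<Rightarrow> (real^'q) set \<Rightarrow> real" where
  "minfdist N v A = (INF y\<in>A. mnorm N (v - y))"

definition scal_feasible ::
    "(real^'q) set \<Rightarrow> (real^'n) set \<Rightarrow> (real^'n \<Rightarrow> real^'q) \<Rightarrow> real^'q \<Rightarrow> real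
      \<Rightarrow> real^'q \<Rightarrow> (real^'n) \<times> (real^'q) \<Rightarrow> bool" where
  "scal_feasible C X \<Gamma> w \<gamma> v = (\<lambda>(x, z).
     x \<in> X \<and> cone_le C (\<Gamma> x - z - v) 0 \<and> w \<bullet> (v + z) \<le> \<gamma>)"

definition scal_optimal ::
    "(real^'q) set \<Rightarrow> (real^'n) set \<Rightarrow> (real^'n \<Rightarrow> real^'q) \<Rightarrow> real^'q \<Rightarrow> real
      \<Rightarrow> real^'q^'q \<Rightarrow> real^'q \<Rightarrow> (real^'n) \<times> (real^'q) \<Rightarrow> bool" where
  "scal_optimal C X \<Gamma> w \<gamma> N v =
     is_arg_min (\<lambda>(x, z). mnorm N z) (scal_feasible C X \<Gamma> w \<gamma> v)"

definition ext :: "(real^'q) set \<Rightarrow> (real^'q) set" where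
  "ext S = {x. x extreme_point_of S}"

text \<open>The suprema are real-valued, so this is the Hausdorff distance only for nonempty
  bounded sets.\<close>

definition hausdorff_dist :: "(real^'q) set \<Rightarrow> (real^'q) set \<Rightarrow> real" where
  "hausdorff_dist S T = max (SUP x\<in>S. infdist x T) (SUP y\<in>T. infdist y S)"

text \<open>Iteration \<open>k\<close> is carried out if no earlier iteration was terminal; \<open>z j (v j)\<close> is the
  displacement at the vertex selected in iteration \<open>j\<close>.\<close>

definition reached ::
    "(nat \<Rightarrow> real^'q \<Rightarrow> real^'q) \<Rightarrow> (nat \<Rightarrow> real^'q) \<Rightarrow> nat \<Rightarrow> bool" where
  "reached z v k \<longleftrightarrow> (\<forall>j<k. z j (v j) \<noteq> 0)"

end

theory Submission
  imports Defs
begin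

text \<open>The point \<open>y\<^sup>k\<close> is the \<open>M\<^sub>k\<close>-projection of \<open>v\<^sup>k\<close> onto the compact convex set \<open>A\<close>, so the
  variational inequality puts \<open>A\<close> into \<open>H\<^bsub>k+1\<^esub>\<close>. For \<open>i < j\<close> the vertex \<open>v\<^sup>j\<close> lies in \<open>H\<^bsub>i+1\<^esub>\<close>
  whereas \<open>v\<^sup>i\<close> lies at \<open>M\<^sub>i\<close>-distance \<open>\<parallel>z\<parallel>\<close> outside it, whence
  \<open>m \<parallel>z\<parallel>\<^sup>2 \<le> Mbar \<parallel>v\<^sup>j - v\<^sup>i\<parallel>\<^sup>2\<close> for \<open>z = z\<^bsub>v\<^sup>i\<^esub>\<close>. The vertices stay in the compact set \<open>A\<^sub>0\<close>, so
  the displacements cannot stay away from \<open>0\<close>; as the selected displacement bounds the distance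
  of every vertex of \<open>A\<^sub>k\<close> to \<open>A\<close> and this distance is monotone in \<open>k\<close>, convergence follows.\<close>

section \<open>Quadratic forms, the Loewner order and projections\<close>

lemma symmetric_quadratic_form_diff:
  fixes N :: "real^'q^'q"
  assumes "transpose N = N"
  shows "(a - b) \<bullet> (N *v (a - b)) = a \<bullet> (N *v a) - 2 * ((N *v b) \<bullet> a) + b \<bullet> (N *v b)"
proof -
  have "b \<bullet> (N *v a) = (N *v b) \<bullet> a"
    by (metis assms dot_lmul_matrix vector_transpose_matrix)
  then show ?thesis
    by (simp add: matrix_vector_mult_diff_distrib inner_diff inner_commute algebra_simps)
qed

lemma loewner_le_scaled_identity_quadratic_form:
  fixes N :: "real^'q^'q"
  shows "loewner_le (c *\<^sub>R mat 1) N \<Longrightarrow> c * (norm d)\<^sup>2 \<le> d \<bullet> (N *v d)"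
    and "loewner_le N (c *\<^sub>R mat 1) \<Longrightarrow> d \<bullet> (N *v d) \<le> c * (norm d)\<^sup>2"
proof -
  have eq: "d \<bullet> ((c *\<^sub>R mat 1 :: real^'q^'q) *v d) = c * (norm d)\<^sup>2"
    by (simp add: scaleR_matrix_vector_assoc [symmetric] power2_norm_eq_inner)
  show "c * (norm d)\<^sup>2 \<le> d \<bullet> (N *v d)" if "loewner_le (c *\<^sub>R mat 1) N"
    using that by (simp add: loewner_le_def psd_matrix_def matrix_vector_mult_diff_rdistrib
        inner_diff_right flip: eq)
  show "d \<bullet> (N *v d) \<le> c * (norm d)\<^sup>2" if "loewner_le N (c *\<^sub>R mat 1)"
    using that by (simp add: loewner_le_def psd_matrix_def matrix_vector_mult_diff_rdistrib
        inner_diff_right flip: eq)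
qed

lemma spd_matrix_imp_psd_matrix: "spd_matrix N \<Longrightarrow> psd_matrix N"
  unfolding spd_matrix_def psd_matrix_def
  by (metis inner_zero_left less_eq_real_def)

text \<open>First-order optimality: if the inequality failed, a short step \<open>t\<close> from
  \<open>u + z\<close> towards \<open>a\<close> would change the squared \<open>N\<close>-distance
  to \<open>u\<close> by \<open>t * (t * q - 2 * p) < 0\<close>, against the minimality of
  \<open>z\<close>.\<close>

lemma projection_variational_inequality:
  assumes N: "psd_matrix N" and S: "convex S" and y: "u + z \<in> S" and a: "a \<in> S"
    and min: "mnorm N z = minfdist N u S"
  shows "(N *v z) \<bullet> (u + z) \<le> (N *v z) \<bullet> a"
proof (rule ccontr)
  assume neg: "\<not> ?thesis"
  define d where "d = u + z - a"
  define p where "p = (N *v z) \<bullet> d"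
  have p: "0 < p"
    using neg by (simp add: p_def d_def inner_diff)
  define q where "q = d \<bullet> (N *v d)"
  have q: "0 \<le> q"
    using N by (simp add: q_def psd_matrix_def)
  \<comment> \<open>The cap 1 keeps the step on the segment; the quotient gives
    \<open>t * q \<le> p\<close>, and the \<open>+ 1\<close> covers \<open>q = 0\<close>.\<close>
  define t where "t = min 1 (p / (q + 1))"
  have t: "0 < t" "t \<le> 1" "t * q < 2 * p"
  proof -
    show "0 < t" "t \<le> 1"
      using p q by (auto simp: t_def)
    have "t * q \<le> p / (q + 1) * q"
      using q by (intro mult_right_mono) (auto simp: t_def)
    also have "\<dots> \<le> p"
      using p q by (simp add: field_simps)
    finally show "t * q < 2 * p"
      using p by simp
  qed
  have "(1 - t) *\<^sub>R (u + z) + t *\<^sub>R a \<in> S"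
    using S y a t by (intro convexD) auto
  moreover have "u - ((1 - t) *\<^sub>R (u + z) + t *\<^sub>R a) = t *\<^sub>R d - z"
    by (simp add: d_def algebra_simps)
  \<comment> \<open>A member bounds the real-valued infimum only if the set is bounded below; 0 is
    such a bound by semidefiniteness.\<close>
  ultimately have "minfdist N u S \<le> mnorm N (t *\<^sub>R d - z)"
    unfolding minfdist_def using N
    by (intro cINF_lower2 [where x = "(1 - t) *\<^sub>R (u + z) + t *\<^sub>R a"] bdd_belowI2 [where m = 0])
      (auto simp: mnorm_def psd_matrix_def)
  then have "z \<bullet> (N *v z) \<le> (t *\<^sub>R d - z) \<bullet> (N *v (t *\<^sub>R d - z))"
    unfolding min [symmetric] by (simp add: mnorm_def)
  also have "\<dots> = t\<^sup>2 * q - 2 * (t * p) + z \<bullet> (N *v z)"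
    using N by (simp add: symmetric_quadratic_form_diff psd_matrix_def p_def q_def
        matrix_scaleR_vector_ac scaleR_matrix_vector_assoc [symmetric] power2_eq_square)
  finally have "t * (2 * p) \<le> t * (t * q)"
    by (simp add: power2_eq_square)
  then show False
    using t by simp
qed

section \<open>Convexity and compactness of the slice\<close>

text \<open>The gap \<open>c\<close> in the \<open>C\<close>-convexity inequality for \<Gamma> is
  itself an element of the cone, so the cone summand absorbs it.\<close>

lemma convex_upper_image:
  assumes C: "convex_cone C" and "convex X" and \<Gamma>: "cone_convex_on C X \<Gamma>"
  shows "convex (upper_image \<Gamma> X C)"
  unfolding convex_alt
proof (intro ballI allI impI)
  fix p1 p2 t
  assume p: "p1 \<in> upper_image \<Gamma> X C" "p2 \<in> upper_image \<Gamma> X C" and t: "0 \<le> t \<and> t \<le> (1::real)"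
  then obtain x1 c1 x2 c2 where x: "x1 \<in> X" "x2 \<in> X" and c: "c1 \<in> C" "c2 \<in> C"
    and p_eq: "p1 = \<Gamma> x1 + c1" "p2 = \<Gamma> x2 + c2"
    by (auto simp: upper_image_def elim!: set_plus_elim)
  define x where "x = (1 - t) *\<^sub>R x1 + t *\<^sub>R x2"
  define c where "c = (1 - t) *\<^sub>R \<Gamma> x1 + t *\<^sub>R \<Gamma> x2 - \<Gamma> x"
  have "x \<in> X"
    using \<open>convex X\<close> x t by (auto simp: x_def convex_alt)
  moreover have "c \<in> C"
    using \<Gamma>[unfolded cone_convex_on_def, rule_format, OF x, of "1 - t"] t
    by (simp add: c_def x_def cone_le_def)
  moreover have "(1 - t) *\<^sub>R c1 + t *\<^sub>R c2 \<in> C"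
    using C c t by (simp add: convex_cone_add convex_cone_scaleR)
  ultimately have "\<Gamma> x + (c + ((1 - t) *\<^sub>R c1 + t *\<^sub>R c2)) \<in> upper_image \<Gamma> X C"
    using C by (auto simp: upper_image_def convex_cone_add)
  then show "(1 - t) *\<^sub>R p1 + t *\<^sub>R p2 \<in> upper_image \<Gamma> X C"
    by (simp add: p_eq c_def algebra_simps)
qed

lemma closed_upper_image:
  assumes "closed C" "compact X" "continuous_on X \<Gamma>"
  shows "closed (upper_image \<Gamma> X C)"
proof -
  have "upper_image \<Gamma> X C = (\<Union>x\<in>\<Gamma> ` X. \<Union>y\<in>C. {x + y})"
    by (auto simp: upper_image_def set_plus_def)
  then show ?thesis
    using assms by (simp only: compact_closed_sums compact_continuous_image)
qed

text \<open>Some ball around \<open>w\<close> lies in the dual cone, so \<open>w\<close> can be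
  tilted by \<open>e\<close> against the direction of \<open>c\<close> and still be nonnegative at
  \<open>c\<close>.\<close>

lemma interior_dual_cone_coercive:
  assumes "w \<in> interior (dual_cone C)"
  obtains e where "0 < e" "\<And>c. c \<in> C \<Longrightarrow> e * norm c \<le> w \<bullet> c"
proof -
  obtain e where e: "0 < e" "cball w e \<subseteq> dual_cone C"
    using assms by (meson mem_interior_cball)
  have "e * norm c \<le> w \<bullet> c" if "c \<in> C" for c
  proof -
    \<comment> \<open>\<open>sgn c\<close> is the unit vector along \<open>c\<close>, and 0 at
      \<open>c = 0\<close>, so the tilt has length at most \<open>e\<close> in both cases.\<close>
    have "w - e *\<^sub>R sgn c \<in> cball w e"
      using \<open>0 < e\<close> by (simp add: dist_norm norm_sgn)
    then have "0 \<le> (w - e *\<^sub>R sgn c) \<bullet> c"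
      using e(2) that unfolding dual_cone_def by blast
    moreover have "sgn c \<bullet> c = norm c"
      by (cases "c = 0") (simp_all add: sgn_div_norm dot_square_norm power2_eq_square)
    ultimately show ?thesis
      by (simp add: inner_diff)
  qed
  with \<open>0 < e\<close> show thesis
    using that by blast
qed

text \<open>For \<open>\<Gamma> x + c\<close> in the slice, \<gamma> and the bound on \<Gamma> over
  \<open>X\<close> limit \<open>w \<bullet> c\<close>; coercivity turns this into a bound on
  \<open>norm c\<close>.\<close>

lemma compact_upper_image_slice:
  assumes "closed C" "compact X" "continuous_on X \<Gamma>" "w \<in> interior (dual_cone C)"
  shows "compact (upper_image \<Gamma> X C \<inter> lower_halfspace w \<gamma>)"
proof -
  obtain e where e: "0 < e" "\<And>c. c \<in> C \<Longrightarrow> e * norm c \<le> w \<bullet> c"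
    using interior_dual_cone_coercive [OF assms(4)] by blast
  obtain B where B: "\<And>x. x \<in> X \<Longrightarrow> norm (\<Gamma> x) \<le> B"
    using compact_imp_bounded [OF compact_continuous_image [OF assms(3,2)]]
    by (auto simp: bounded_iff)
  have "norm p \<le> B + (\<gamma> + norm w * B) / e"
    if p: "p \<in> upper_image \<Gamma> X C \<inter> lower_halfspace w \<gamma>" for p
  proof -
    obtain x c where xc: "x \<in> X" "c \<in> C" "p = \<Gamma> x + c"
      using p by (auto simp: upper_image_def elim!: set_plus_elim)
    have "w \<bullet> p \<le> \<gamma>"
      using p by (simp add: lower_halfspace_def)
    have "- (w \<bullet> \<Gamma> x) \<le> norm w * norm (\<Gamma> x)"
      using norm_cauchy_schwarz [of "- w" "\<Gamma> x"] by simp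
    also have "\<dots> \<le> norm w * B"
      using B xc by (simp add: mult_left_mono)
    finally have "e * norm c \<le> \<gamma> + norm w * B"
      using e(2) [OF xc(2)] \<open>w \<bullet> p \<le> \<gamma>\<close> xc(3) by (simp add: inner_add)
    then have "norm c \<le> (\<gamma> + norm w * B) / e"
      using \<open>0 < e\<close> by (simp add: field_simps)
    then show ?thesis
      using norm_triangle_ineq [of "\<Gamma> x" c] B xc by fastforce
  qed
  then have "bounded (upper_image \<Gamma> X C \<inter> lower_halfspace w \<gamma>)"
    unfolding bounded_iff by blast
  moreover have "closed (upper_image \<Gamma> X C \<inter> lower_halfspace w \<gamma>)"
    using assms closed_upper_image unfolding lower_halfspace_def
    by (intro closed_Int closed_halfspace_le) blast
  ultimately show ?thesis
    by (simp add: compact_eq_bounded_closed)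
qed

text \<open>The slack \<open>u + z - \<Gamma> x\<close> of the cone constraint serves as the cone
  summand. This is what puts every displaced vertex into \<open>A\<close>.\<close>

lemma scal_feasible_imp_mem_slice:
  assumes "scal_feasible C X \<Gamma> w \<gamma> u (x, z)"
  shows "u + z \<in> upper_image \<Gamma> X C \<inter> lower_halfspace w \<gamma>"
proof -
  have "\<Gamma> x + (u + z - \<Gamma> x) \<in> \<Gamma> ` X + C"
    using assms by (intro set_plus_intro) (auto simp: scal_feasible_def cone_le_def algebra_simps)
  then show ?thesis
    using assms by (simp add: scal_feasible_def upper_image_def lower_halfspace_def)
qed

section \<open>Distance from a polytope to a convex set, and separation in compact sets\<close>

text \<open>The neighbourhood \<open>A + cball 0 d\<close> is convex and contains \<open>V\<close>,
  hence also its hull. Nearest points in the closed set \<open>A\<close> give the inclusion of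
  \<open>V\<close>.\<close>

lemma infdist_le_on_convex_hull:
  fixes A :: "'a::euclidean_space set"
  assumes A: "convex A" "closed A" "A \<noteq> {}" and V: "\<And>u. u \<in> V \<Longrightarrow> infdist u A \<le> d"
    and x: "x \<in> convex hull V"
  shows "infdist x A \<le> d"
proof -
  have "V \<subseteq> A + cball 0 d"
  proof
    fix u assume "u \<in> V"
    obtain a where "a \<in> A" "infdist u A = dist u a"
      using infdist_attains_inf [OF A(2,3)] by blast
    then have "a + (u - a) \<in> A + cball 0 d"
      using V [OF \<open>u \<in> V\<close>] by (intro set_plus_intro) (auto simp: dist_norm norm_minus_commute)
    then show "u \<in> A + cball 0 d"
      by simp
  qed
  then have "convex hull V \<subseteq> A + cball 0 d"
    by (intro hull_minimal convex_set_plus A(1) convex_cball)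
  then obtain a b where "a \<in> A" "norm b \<le> d" "x = a + b"
    using x by (auto elim!: set_plus_elim)
  then show ?thesis
    using infdist_le [of a A x] by (simp add: dist_norm)
qed

lemma finite_ext_polytope: "polytope S \<Longrightarrow> finite (ext S)"
  unfolding ext_def using finite_polyhedron_extreme_points polytope_imp_polyhedron by blast

lemma polytope_eq_convex_hull_ext: "polytope S \<Longrightarrow> S = convex hull (ext S)"
  unfolding ext_def by (simp add: Krein_Milman_Minkowski polytope_imp_compact polytope_imp_convex)

lemma ext_polytope_nonempty: "polytope S \<Longrightarrow> S \<noteq> {} \<Longrightarrow> ext S \<noteq> {}"
  using polytope_eq_convex_hull_ext by fastforce

lemma infdist_le_Max_ext:
  assumes "convex A" "closed A" "A \<noteq> {}" "polytope S" "x \<in> S"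
  shows "infdist x A \<le> Max ((\<lambda>u. infdist u A) ` ext S)"
proof (rule infdist_le_on_convex_hull [OF assms(1-3)])
  show "x \<in> convex hull (ext S)"
    using assms polytope_eq_convex_hull_ext by blast
qed (simp add: assms finite_ext_polytope)

text \<open>Since \<open>A \<subseteq> S\<close>, one of the two suprema vanishes; the other is
  attained at a vertex, because the distance to a convex set is controlled by the vertices.\<close>

lemma hausdorff_dist_polytope:
  assumes "convex A" "closed A" "A \<noteq> {}" "polytope S" "A \<subseteq> S"
  shows "hausdorff_dist S A = Max ((\<lambda>u. infdist u A) ` ext S)" (is "_ = ?M")
proof -
  have ext: "finite (ext S)" "ext S \<noteq> {}" "ext S \<subseteq> S"
    using assms finite_ext_polytope ext_polytope_nonempty by (auto simp: ext_def extreme_point_of_def)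
  have "(SUP x\<in>S. infdist x A) = ?M"
  proof (rule cSup_eq_maximum)
    show "?M \<in> (\<lambda>x. infdist x A) ` S"
      using Max_in [of "(\<lambda>u. infdist u A) ` ext S"] ext by blast
  qed (use infdist_le_Max_ext [OF assms(1-4)] in auto)
  moreover have "(SUP y\<in>A. infdist y S) = (SUP y\<in>A. 0)"
    using assms by (intro SUP_cong) auto
  moreover have "0 \<le> ?M"
    using assms infdist_le_Max_ext [OF assms(1-4)] infdist_nonneg order_trans by blast
  ultimately show ?thesis
    using assms by (simp add: hausdorff_dist_def)
qed

text \<open>A convergent subsequence is Cauchy, so two consecutive terms far enough along it are
  close.\<close>

lemma compact_imp_not_uniformly_separated:
  fixes v :: "nat \<Rightarrow> 'a::metric_space"
  assumes "compact S" "\<And>k. v k \<in> S" "0 < e"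
  obtains i j where "i < j" "dist (v i) (v j) < e"
proof -
  obtain r l where r: "strict_mono r" "(v \<circ> r) \<longlonglongrightarrow> l"
    using assms unfolding compact_def by meson
  obtain n where "\<And>i j. n \<le> i \<Longrightarrow> n \<le> j \<Longrightarrow> dist ((v \<circ> r) i) ((v \<circ> r) j) < e"
    using metric_CauchyD [OF LIMSEQ_imp_Cauchy [OF r(2)] \<open>0 < e\<close>] by blast
  then have "dist (v (r n)) (v (r (Suc n))) < e"
    by simp
  then show thesis
    using that r(1) by (meson lessI strict_monoD)
qed

theorem theorem12:
  fixes C :: "(real^'q) set" and X :: "(real^'n) set" and \<Gamma> :: "real^'n \<Rightarrow> real^'q"
    and P A :: "(real^'q) set" and wbar :: "real^'q" and \<alpha> \<gamma> m Mbar :: real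
    and Mat :: "nat \<Rightarrow> real^'q^'q" and Ak H :: "nat \<Rightarrow> (real^'q) set"
    and xs :: "nat \<Rightarrow> real^'q \<Rightarrow> real^'n" and z :: "nat \<Rightarrow> real^'q \<Rightarrow> real^'q"
    and v y g :: "nat \<Rightarrow> real^'q"
  assumes "closed C" "convex_cone C" "interior C \<noteq> {}" "C \<inter> uminus ` C = {0}"
      "C \<noteq> {0}" "C \<noteq> UNIV" "polyhedron C"
    and "X \<noteq> {}" "compact X" "convex X" "interior X \<noteq> {}"
    and "continuous_on X \<Gamma>" "cone_convex_on C X \<Gamma>"
    and "P = upper_image \<Gamma> X C"
    and "wbar \<in> interior (dual_cone C)"
    and "\<alpha> > 0" "\<gamma> = (SUP x\<in>X. wbar \<bullet> \<Gamma> x) + \<alpha>"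
      "\<Gamma> ` X \<subseteq> interior (lower_halfspace wbar \<gamma>)"
    and "A = P \<inter> lower_halfspace wbar \<gamma>"
    and "polytope (Ak 0)" "A \<subseteq> Ak 0"
    and "0 < m" "m \<le> Mbar"
    and "\<And>k. spd_matrix (Mat k)"
    and "\<And>k. loewner_le (m *\<^sub>R mat 1) (Mat k) \<and> loewner_le (Mat k) (Mbar *\<^sub>R mat 1)"
    and "\<And>k u. reached z v k \<Longrightarrow> u \<in> ext (Ak k) \<Longrightarrow>
           scal_optimal C X \<Gamma> wbar \<gamma> (Mat k) u (xs k u, z k u) \<and>
           mnorm (Mat k) (z k u) = minfdist (Mat k) u A"
    and "\<And>k. reached z v k \<Longrightarrow>
           is_arg_max (\<lambda>u. mnorm (Mat k) (z k u)) (\<lambda>u. u \<in> ext (Ak k)) (v k)"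
    and "\<And>k. reached z v k \<Longrightarrow> z k (v k) \<noteq> 0 \<Longrightarrow>
           y k = v k + z k (v k) \<and>
           g k = (Mat k *v z k (v k)) /\<^sub>R mnorm (Mat k) (z k (v k)) \<and>
           H (Suc k) = {p. g k \<bullet> p \<ge> g k \<bullet> y k} \<and>
           Ak (Suc k) = Ak k \<inter> H (Suc k)"
    and "\<And>k j. reached z v k \<Longrightarrow> z k (v k) = 0 \<Longrightarrow> k \<le> j \<Longrightarrow> Ak j = Ak k"
  shows "(\<forall>k. reached z v k \<and> z k (v k) \<noteq> 0 \<longrightarrow> A \<subseteq> H (Suc k)) \<and>
         (\<lambda>k. hausdorff_dist (Ak k) A) \<longlonglongrightarrow> 0 \<and>
         (\<lambda>k. Max ((\<lambda>u. infdist u A) ` ext (Ak k))) \<longlonglongrightarrow> 0"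
proof -
  have "psd_matrix (Mat k)" for k
    using assms(24) by (rule spd_matrix_imp_psd_matrix)
  have "convex A" "closed A"
    using compact_upper_image_slice [OF assms(1,9,12,15)] convex_upper_image [OF assms(2,10,13)]
    by (auto simp: assms(14,19) lower_halfspace_def compact_imp_closed
        intro!: convex_Int convex_halfspace_le)
  have "A \<noteq> {}"
  proof -
    obtain x where "x \<in> X"
      using assms(8) by blast
    then have "\<Gamma> x + 0 \<in> upper_image \<Gamma> X C"
      using convex_cone_contains_0 [OF assms(2)] unfolding upper_image_def by (intro set_plus_intro) auto
    moreover have "\<Gamma> x \<in> lower_halfspace wbar \<gamma>"
      using \<open>x \<in> X\<close> assms(18) interior_subset [of "lower_halfspace wbar \<gamma>"] by fast
    ultimately show ?thesis
      unfolding assms(14,19) by auto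
  qed
  note A = \<open>convex A\<close> \<open>closed A\<close> \<open>A \<noteq> {}\<close>
  have reached_Suc: "reached z v (Suc k) \<longleftrightarrow> reached z v k \<and> z k (v k) \<noteq> 0" for k
    by (auto simp: reached_def less_Suc_eq)
  have v_ext: "v k \<in> ext (Ak k)" if "reached z v k" for k
    using assms(27) [OF that] by (simp add: is_arg_max_def)
  have A_eq: "A = upper_image \<Gamma> X C \<inter> lower_halfspace wbar \<gamma>"
    using assms(14,19) by simp
  have proj: "u + z k u \<in> A" if "reached z v k" "u \<in> ext (Ak k)" for k u
  proof -
    have "scal_feasible C X \<Gamma> wbar \<gamma> u (xs k u, z k u)"
      using assms(26) [OF that] by (simp add: scal_optimal_def is_arg_min_def)
    then show ?thesis
      unfolding A_eq by (rule scal_feasible_imp_mem_slice)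
  qed
  \<comment> \<open>The normalization of \<open>g k\<close> is a positive factor and cancels, which
    leaves the form of the variational inequality.\<close>
  have g_le_iff: "g k \<bullet> y k \<le> g k \<bullet> p \<longleftrightarrow>
      (Mat k *v z k (v k)) \<bullet> (v k + z k (v k)) \<le> (Mat k *v z k (v k)) \<bullet> p"
    if "reached z v k" "z k (v k) \<noteq> 0" for k p
  proof -
    have "0 < mnorm (Mat k) (z k (v k))"
      using assms(24) [of k] that(2) by (simp add: mnorm_def spd_matrix_def)
    then show ?thesis
      using assms(28) [OF that] by (simp add: divide_simps)
  qed
  have A_H: "A \<subseteq> H (Suc k)" if "reached z v k" "z k (v k) \<noteq> 0" for k
  proof
    fix p assume "p \<in> A"
    have "mnorm (Mat k) (z k (v k)) = minfdist (Mat k) (v k) A"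
      using assms(26) v_ext that(1) by blast
    then have "g k \<bullet> y k \<le> g k \<bullet> p"
      unfolding g_le_iff [OF that]
      by (intro projection_variational_inequality [OF \<open>psd_matrix (Mat k)\<close> A(1)]
          proj v_ext that(1) \<open>p \<in> A\<close>)
    moreover have "H (Suc k) = {p. g k \<bullet> p \<ge> g k \<bullet> y k}"
      using assms(28) [OF that] by blast
    ultimately show "p \<in> H (Suc k)"
      by simp
  qed
  \<comment> \<open>\<open>reached z v (Suc k)\<close> says exactly that iteration \<open>k\<close>
    is carried out and is nonterminal, so a single recursion also covers the constant tail after
    termination.\<close>
  have Ak_Suc: "Ak (Suc k) = (if reached z v (Suc k) then Ak k \<inter> H (Suc k) else Ak k)" for k
  proof (cases "reached z v (Suc k)")
    case False
    \<comment> \<open>The first index with zero displacement is itself reached, so the stationarity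
      assumption applies from \<open>j\<close> on.\<close>
    define j where "j = (LEAST j. z j (v j) = 0)"
    obtain i where "i \<le> k" "z i (v i) = 0"
      using False by (auto simp: reached_def less_Suc_eq_le)
    have "z j (v j) = 0"
      unfolding j_def using \<open>z i (v i) = 0\<close> by (rule LeastI)
    moreover have "j \<le> i"
      unfolding j_def using \<open>z i (v i) = 0\<close> by (rule Least_le)
    moreover have "reached z v j"
      unfolding j_def reached_def using not_less_Least by blast
    ultimately have "z j (v j) = 0" "reached z v j" "j \<le> k"
      using \<open>i \<le> k\<close> by auto
    then have "Ak (Suc k) = Ak j" "Ak k = Ak j"
      using assms(29) [of j k] assms(29) [of j "Suc k"] le_SucI by blast+
    then show ?thesis
      using False by presburger
  next
    case True
    then have "Ak (Suc k) = Ak k \<inter> H (Suc k)"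
      using assms(28) reached_Suc by blast
    then show ?thesis
      using True by presburger
  qed
  have Ak: "polytope (Ak k) \<and> A \<subseteq> Ak k" for k
  proof (induction k)
    case (Suc k)
    have "polytope (Ak k \<inter> H (Suc k))" if "reached z v (Suc k)"
    proof -
      have "H (Suc k) = {p. g k \<bullet> p \<ge> g k \<bullet> y k}"
        using assms(28) reached_Suc that by blast
      then show ?thesis
        using Suc by (metis polytope_Int_polyhedron polyhedron_halfspace_ge)
    qed
    then show ?case
      using Suc A_H reached_Suc by (simp add: Ak_Suc)
  qed (use assms in simp)
  have "decseq Ak"
    by (rule decseq_SucI) (simp add: Ak_Suc)
  have ext_sub: "ext (Ak k) \<subseteq> Ak k" for k
    by (auto simp: ext_def extreme_point_of_def)
  have ext: "finite (ext (Ak k))" "ext (Ak k) \<noteq> {}" for k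
    using Ak [of k] \<open>A \<noteq> {}\<close> finite_ext_polytope ext_polytope_nonempty [of "Ak k"] by blast+

  \<comment> \<open>Displacements against vertex distances\<close>
  define D where "D k = Max ((\<lambda>u. infdist u A) ` ext (Ak k))" for k
  have D_attained: "\<exists>u\<in>ext (Ak k). D k = infdist u A" for k
    unfolding D_def using Max_in [of "(\<lambda>u. infdist u A) ` ext (Ak k)"] ext [of k] by blast
  have D_nonneg: "0 \<le> D k" for k
    using D_attained [of k] infdist_nonneg by auto
  \<comment> \<open>A vertex of a later polytope need not be a vertex of an earlier one, but it lies
    in it, and the maximum over the earlier vertices bounds its distance.\<close>
  have "decseq D"
    unfolding decseq_def
  proof (intro allI impI)
    fix i j :: nat assume "i \<le> j"
    obtain u where "u \<in> ext (Ak j)" "D j = infdist u A"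
      using D_attained by blast
    moreover have "ext (Ak j) \<subseteq> Ak i"
      using ext_sub decseqD [OF \<open>decseq Ak\<close> \<open>i \<le> j\<close>] by blast
    ultimately show "D j \<le> D i"
      unfolding D_def using infdist_le_Max_ext [OF A] Ak by auto
  qed
  define E where "E k = z k (v k) \<bullet> (Mat k *v z k (v k))" for k
  \<comment> \<open>The worst vertex \<open>u\<close> moves into \<open>A\<close>, so its
    displacement is at least \<open>D k\<close> long; by the choice of \<open>v k\<close> it is no
    longer in the \<open>Mat k\<close> norm than the selected one.\<close>
  have D_E: "m * (D k)\<^sup>2 \<le> E k" if "reached z v k" for k
  proof -
    obtain u where u: "u \<in> ext (Ak k)" "D k = infdist u A"
      using D_attained by blast
    have "D k \<le> norm (z k u)"
      using infdist_le [OF proj [OF that u(1)], of u] u(2) by (simp add: dist_norm)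
    then have "m * (D k)\<^sup>2 \<le> m * (norm (z k u))\<^sup>2"
      using D_nonneg assms(22) by (intro mult_left_mono power_mono) auto
    also have "\<dots> \<le> z k u \<bullet> (Mat k *v z k u)"
      by (rule loewner_le_scaled_identity_quadratic_form(1)) (use assms(25) in blast)
    also have "\<dots> \<le> E k"
      using assms(27) [OF that] u(1) by (simp add: is_arg_max_linorder mnorm_def E_def)
    finally show ?thesis .
  qed
  have E_v: "E i \<le> Mbar * (norm (v j - v i))\<^sup>2" if "reached z v j" "i < j" for i j
  proof -
    have i: "reached z v i" "z i (v i) \<noteq> 0"
      using that by (auto simp: reached_def)
    \<comment> \<open>The cut made in iteration \<open>i\<close> first acts on
      \<open>Ak (Suc i)\<close>, and \<open>i < j\<close> gives
      \<open>Suc i \<le> j\<close>.\<close>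
    have "v j \<in> Ak (Suc i)"
      using v_ext [OF that(1)] ext_sub decseqD [OF \<open>decseq Ak\<close>, of "Suc i" j] that(2) by auto
    then have "g i \<bullet> y i \<le> g i \<bullet> v j"
      using assms(28) [OF i] by simp
    then have le: "E i \<le> (Mat i *v z i (v i)) \<bullet> (v j - v i)"
      unfolding g_le_iff [OF i] E_def
      by (simp add: inner_add_right inner_diff_left inner_diff_right inner_commute)
    \<comment> \<open>This replaces Cauchy-Schwarz: with \<open>d = v j - v i\<close>, expansion
      gives twice the right side of \<open>le\<close> at most
      \<open>d \<bullet> (Mat i *v d) + E i\<close>, and \<open>le\<close> bounds it below by
      \<open>2 * E i\<close>.\<close>
    have "0 \<le> (v j - v i - z i (v i)) \<bullet> (Mat i *v (v j - v i - z i (v i)))"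
      using \<open>psd_matrix (Mat i)\<close> by (simp add: psd_matrix_def)
    then have "E i \<le> (v j - v i) \<bullet> (Mat i *v (v j - v i))"
      using \<open>psd_matrix (Mat i)\<close> le
      by (simp add: symmetric_quadratic_form_diff [of _ "v j - v i"] psd_matrix_def E_def)
    also have "\<dots> \<le> Mbar * (norm (v j - v i))\<^sup>2"
      by (rule loewner_le_scaled_identity_quadratic_form(2)) (use assms(25) in blast)
    finally show ?thesis .
  qed

  \<comment> \<open>Convergence\<close>
  have D_small: "\<exists>k. D k < \<epsilon>" if "0 < \<epsilon>" for \<epsilon>
  proof (rule ccontr)
    assume "\<nexists>k. D k < \<epsilon>"
    then have D_ge: "\<epsilon> \<le> D k" for k
      by (simp add: not_less)
    \<comment> \<open>A terminal iteration would have \<open>E k = 0\<close> and hence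
      \<open>D k = 0\<close>, so under the contrary assumption the algorithm never stops.\<close>
    have reached: "reached z v k" for k
    proof (induction k)
      case (Suc k)
      have "0 < m * (D k)\<^sup>2"
        using D_ge [of k] \<open>0 < \<epsilon>\<close> assms(22) by simp
      then have "E k \<noteq> 0"
        using D_E [OF Suc] by linarith
      then show ?case
        using Suc by (auto simp: reached_Suc E_def)
    qed (simp add: reached_def)
    have "v k \<in> Ak 0" for k
      using v_ext [OF reached] ext_sub decseqD [OF \<open>decseq Ak\<close>, of 0 k] by blast
    \<comment> \<open>This radius is the separation forced by \<open>m * \<epsilon>\<^sup>2 \<le> E
      i \<le> Mbar * (norm (v j - v i))\<^sup>2\<close>; a closer pair is contradictory.\<close>
    moreover have "0 < \<epsilon> * sqrt (m / Mbar)"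
      using \<open>0 < \<epsilon>\<close> assms(22,23) by simp
    ultimately obtain i j where "i < j" "dist (v i) (v j) < \<epsilon> * sqrt (m / Mbar)"
      using compact_imp_not_uniformly_separated polytope_imp_compact [OF assms(20)] by metis
    then have "(norm (v j - v i))\<^sup>2 < (\<epsilon> * sqrt (m / Mbar))\<^sup>2"
      by (intro power_strict_mono) (auto simp: dist_norm norm_minus_commute)
    also have "\<dots> = m * \<epsilon>\<^sup>2 / Mbar"
      using assms(22,23) by (simp add: power_mult_distrib)
    finally have "Mbar * (norm (v j - v i))\<^sup>2 < m * \<epsilon>\<^sup>2"
      using assms(22,23) by (simp add: field_simps)
    also have "\<dots> \<le> m * (D i)\<^sup>2"
      using D_ge \<open>0 < \<epsilon>\<close> assms(22) by (intro mult_left_mono power_mono) auto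
    also have "\<dots> \<le> Mbar * (norm (v j - v i))\<^sup>2"
      using D_E [OF reached] E_v [OF reached \<open>i < j\<close>] by (rule order_trans)
    finally show False
      by simp
  qed
  \<comment> \<open>By monotonicity, a single value below \<epsilon> keeps all later ones below
    it.\<close>
  have "D \<longlonglongrightarrow> 0"
  proof (rule decreasing_tendsto)
    fix \<epsilon> :: real assume "0 < \<epsilon>"
    then obtain k where "D k < \<epsilon>"
      using D_small by blast
    then show "\<forall>\<^sub>F n in sequentially. D n < \<epsilon>"
      using \<open>decseq D\<close> by (auto simp: decseq_def eventually_sequentially intro: le_less_trans)
  qed (simp add: D_nonneg)
  moreover have "hausdorff_dist (Ak k) A = D k" for k
    unfolding D_def using hausdorff_dist_polytope [OF A] Ak by blast
  ultimately show ?thesis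
    using A_H by (simp flip: D_def)
qed

end
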